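(* Let $p=\sum_{k=1}^m w_kp_k$ be a mixture of probability distributions $p_k$ on $\{0,1\}^d$, with weights $w_k>0$, $\sum_k w_k=1$. Let $P$ be the transition kernel of Glauber dynamics with stationary distribution $p$ and $\mathscr{L}=P-I$; for each $k$ let $P_k$ be the transition kernel of Glauber dynamics with stationary distribution $p_k$ and $\mathscr{L}_k=P_k-I$. Then for every $f:\{0,1\}^d\to\mathbb{R}$, $$\langle f,\mathscr{L}f\rangle_p\le\sum_{k=1}^m w_k\langle f,\mathscr{L}_kf\rangle_{p_k}.$$
   Context: Glauber dynamics for a distribution $p$ on $\{0,1\}^d$: from state $x$, pick a coordinate $i\in\{1,\dots,d\}$ uniformly at random and flip $x_i$ with probability $p(X_i=1-x_i\mid X_{-i}=x_{-i})=\frac{p(x^{\oplus i})}{p(x)+p(x^{\oplus i})}$, where $x^{\oplus i}$ is $x$ with its $i$-th coordinate flipped; otherwise stay at $x$ (any convention may be used when $p(x)+p(x^{\oplus i})=0$). $\langle f,g\rangle_p=\sum_x f(x)g(x)p(x)$, and $(Pf)(x)=\sum_yP(y\mid x)f(y)$. *)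

theory Defs
  imports "HOL-Probability.Probability"
begin

text \<open>
  The cube \<open>{0,1}\<^sup>d\<close> is the type \<^typ>\<open>'d \<Rightarrow> bool\<close> over a finite
  (nonempty) index type \<^typ>\<open>'d::finite\<close> with \<open>d\<close> elements, reading \<^const>\<open>False\<close> as 0
  and \<^const>\<open>True\<close> as 1.
\<close>

definition flip_coord :: "('d \<Rightarrow> bool) \<Rightarrow> 'd \<Rightarrow> ('d \<Rightarrow> bool)" where
  "flip_coord x i = x(i := \<not> x i)"

text \<open>
  The conditional probability of flipping is undetermined where the conditioning event is null;
  there it is given by an arbitrary convention \<open>c\<close>.
\<close>

definition flip_prob ::
  "(('d \<Rightarrow> bool) \<Rightarrow> 'd \<Rightarrow> real) \<Rightarrow> ('d \<Rightarrow> bool) pmf \<Rightarrow> ('d \<Rightarrow> bool) \<Rightarrow> 'd \<Rightarrow> real" where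
  "flip_prob c p x i =
    (if pmf p x + pmf p (flip_coord x i) = 0 then c x i
     else pmf p (flip_coord x i) / (pmf p x + pmf p (flip_coord x i)))"

definition glauber_kernel ::
  "(('d::finite \<Rightarrow> bool) \<Rightarrow> 'd \<Rightarrow> real) \<Rightarrow> ('d \<Rightarrow> bool) pmf \<Rightarrow> ('d \<Rightarrow> bool) \<Rightarrow> ('d \<Rightarrow> bool) pmf" where
  "glauber_kernel c p x =
    bind_pmf (pmf_of_set UNIV) (\<lambda>i.
    bind_pmf (bernoulli_pmf (flip_prob c p x i)) (\<lambda>b.
    return_pmf (if b then flip_coord x i else x)))"

definition is_glauber_kernel ::
  "('d::finite \<Rightarrow> bool) pmf \<Rightarrow> (('d \<Rightarrow> bool) \<Rightarrow> ('d \<Rightarrow> bool) pmf) \<Rightarrow> bool" where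
  "is_glauber_kernel p P \<longleftrightarrow>
    (\<exists>c. (\<forall>x i. 0 \<le> c x i \<and> c x i \<le> 1) \<and> P = glauber_kernel c p)"

definition inner_pmf :: "'s::finite pmf \<Rightarrow> ('s \<Rightarrow> real) \<Rightarrow> ('s \<Rightarrow> real) \<Rightarrow> real" where
  "inner_pmf p f g = (\<Sum>x\<in>UNIV. f x * g x * pmf p x)"

definition kernel_op :: "('s::finite \<Rightarrow> 's pmf) \<Rightarrow> ('s \<Rightarrow> real) \<Rightarrow> 's \<Rightarrow> real" where
  "kernel_op P f x = (\<Sum>y\<in>UNIV. pmf (P x) y * f y)"

definition generator :: "('s::finite \<Rightarrow> 's pmf) \<Rightarrow> ('s \<Rightarrow> real) \<Rightarrow> 's \<Rightarrow> real" where
  "generator P f x = kernel_op P f x - f x"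

end

theory Submission
  imports Defs
begin

text \<open>
  The generator of Glauber dynamics satisfies
  \<open>\<langle>f, L f\<rangle> = - (1 / 2d) \<Sum>i x. h(p x, p (x\<oplus>i)) (f (x\<oplus>i) - f x)\<^sup>2\<close> with
  \<open>h(a, b) = a b / (a + b)\<close>, half the harmonic mean. Since
  \<open>h(a, b) = min\<^sub>t ((1 - t)\<^sup>2 a + t\<^sup>2 b)\<close> is a minimum of linear functions,
  \<open>h\<close> is superadditive and homogeneous, so mixing can only increase the Dirichlet form.
\<close>

text \<open>This is the \<open>h\<close> above. At \<open>a = b = 0\<close> division by zero yields
  0, which is also the continuous extension from nonnegative arguments.\<close>

definition parallel_sum :: "real \<Rightarrow> real \<Rightarrow> real" where
  "parallel_sum a b = a * b / (a + b)"

lemma parallel_sum_commute: "parallel_sum a b = parallel_sum b a"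
  by (simp add: parallel_sum_def ac_simps)

text \<open>After multiplication by \<open>a + b\<close>, the gap between the two sides is the
  square of \<open>(1 - t) * a - t * b\<close>. For fixed \<open>t\<close> the bound is linear in
  \<open>(a, b)\<close>, so it can be summed.\<close>

lemma parallel_sum_le:
  assumes "a \<ge> 0" "b \<ge> 0"
  shows "parallel_sum a b \<le> (1 - t)\<^sup>2 * a + t\<^sup>2 * b"
proof (cases "a + b = 0")
  case True
  with assms show ?thesis by (simp add: parallel_sum_def)
next
  case False
  have "((1 - t)\<^sup>2 * a + t\<^sup>2 * b) * (a + b) - a * b = ((1 - t) * a - t * b)\<^sup>2"
    by (simp add: power2_eq_square algebra_simps)
  then have "a * b \<le> ((1 - t)\<^sup>2 * a + t\<^sup>2 * b) * (a + b)"
    by (smt (verit) zero_le_power2)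
  with False assms show ?thesis
    by (simp add: parallel_sum_def pos_divide_le_eq)
qed

text \<open>The value \<open>t = a / (a + b)\<close> makes that square vanish, so the linear bound
  is attained.\<close>

lemma parallel_sum_eq:
  assumes "a + b \<noteq> 0"
  shows "parallel_sum a b = (1 - a / (a + b))\<^sup>2 * a + (a / (a + b))\<^sup>2 * b"
proof -
  have "1 - a / (a + b) = b / (a + b)"
    using assms by (simp add: field_simps)
  moreover have "(b / (a + b))\<^sup>2 * a + (a / (a + b))\<^sup>2 * b = a * b * (a + b) / (a + b)\<^sup>2"
    by (simp add: power_divide add_divide_distrib[symmetric])
       (simp add: power2_eq_square algebra_simps)
  ultimately show ?thesis
    using assms by (simp add: parallel_sum_def power2_eq_square)
qed

lemma sum_parallel_sum_le:
  fixes w a b :: "'k \<Rightarrow> real"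
  assumes "\<And>k. k \<in> K \<Longrightarrow> w k \<ge> 0" "\<And>k. k \<in> K \<Longrightarrow> a k \<ge> 0" "\<And>k. k \<in> K \<Longrightarrow> b k \<ge> 0"
  shows "(\<Sum>k\<in>K. w k * parallel_sum (a k) (b k))
    \<le> parallel_sum (\<Sum>k\<in>K. w k * a k) (\<Sum>k\<in>K. w k * b k)"
proof -
  define A B where "A = (\<Sum>k\<in>K. w k * a k)" and "B = (\<Sum>k\<in>K. w k * b k)"
  \<comment> \<open>The minimiser for the totals; using this single \<open>t\<close> for every
    \<open>k\<close> lets the linear bounds add up to an expression in \<open>A\<close> and
    \<open>B\<close> alone.\<close>
  define t where "t = A / (A + B)"
  have "(\<Sum>k\<in>K. w k * parallel_sum (a k) (b k))
      \<le> (\<Sum>k\<in>K. w k * ((1 - t)\<^sup>2 * a k + t\<^sup>2 * b k))"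
    by (intro sum_mono mult_left_mono parallel_sum_le assms)
  also have "\<dots> = (1 - t)\<^sup>2 * A + t\<^sup>2 * B"
    by (simp add: A_def B_def sum_distrib_left sum.distrib algebra_simps)
  also have "\<dots> = parallel_sum A B"
  proof (cases "A + B = 0")
    case True
    moreover have "A \<ge> 0" "B \<ge> 0"
      unfolding A_def B_def by (intro sum_nonneg mult_nonneg_nonneg assms; assumption)+
    ultimately have "A = 0" "B = 0" by linarith+
    then show ?thesis by (simp add: parallel_sum_def)
  next
    case False
    then show ?thesis by (simp add: parallel_sum_eq t_def)
  qed
  finally show ?thesis by (simp add: A_def B_def)
qed

lemma flip_coord_flip_coord [simp]: "flip_coord (flip_coord x i) i = x"
  by (auto simp: flip_coord_def)

lemma bij_flip_coord: "bij (\<lambda>x. flip_coord x i)"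
  by (rule bij_betw_byWitness[where f' = "\<lambda>x. flip_coord x i"]) auto

lemma flip_prob_bounds:
  assumes "0 \<le> c x i" "c x i \<le> 1"
  shows "0 \<le> flip_prob c p x i" "flip_prob c p x i \<le> 1"
  using assms add_nonneg_nonneg[OF pmf_nonneg[of p x] pmf_nonneg[of p "flip_coord x i"]]
  by (auto simp: flip_prob_def divide_le_eq_1 less_le)

text \<open>Detailed balance: the flow from \<open>x\<close> to its flip is symmetric in the two
  states. In the null case the factor \<open>pmf p x = 0\<close> removes the arbitrary value of
  \<open>c\<close>.\<close>

lemma pmf_mult_flip_prob:
  "pmf p x * flip_prob c p x i = parallel_sum (pmf p x) (pmf p (flip_coord x i))"
  by (simp add: flip_prob_def parallel_sum_def add_nonneg_eq_0_iff)

text \<open>The bounds on \<open>c\<close> put \<open>flip_prob\<close> in the unit interval, so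
  \<open>bernoulli_pmf\<close> has exactly this parameter.\<close>

lemma generator_glauber_kernel:
  fixes p :: "('d::finite \<Rightarrow> bool) pmf"
  assumes "\<And>x i. 0 \<le> c x i \<and> c x i \<le> 1"
  shows "generator (glauber_kernel c p) f x
    = (\<Sum>i\<in>UNIV. flip_prob c p x i * (f (flip_coord x i) - f x)) / CARD('d)"
proof -
  have "kernel_op (glauber_kernel c p) f x = measure_pmf.expectation (glauber_kernel c p x) f"
    by (simp add: kernel_op_def integral_measure_pmf_real[where A = UNIV] mult.commute)
  also have "\<dots> = (\<Sum>i\<in>UNIV. f x + flip_prob c p x i * (f (flip_coord x i) - f x)) / CARD('d)"
    using assms
    by (simp add: glauber_kernel_def pmf_expectation_bind[where A = UNIV]
        integral_pmf_of_set)
       (simp add: UNIV_bool flip_prob_bounds add_divide_distrib diff_divide_distrib sum_divide_distrib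
         algebra_simps)
  finally show ?thesis
    by (simp add: generator_def sum.distrib add_divide_distrib)
qed

text \<open>The Dirichlet form as a sum over edges of the cube. The right-hand side is free of
  \<open>c\<close>, so different kernels may follow unrelated conventions.\<close>

lemma inner_pmf_generator_glauber:
  fixes p :: "('d::finite \<Rightarrow> bool) pmf"
  assumes "is_glauber_kernel p P"
  shows "inner_pmf p f (generator P f)
    = - (\<Sum>i\<in>UNIV. \<Sum>x\<in>UNIV. parallel_sum (pmf p x) (pmf p (flip_coord x i))
          * (f (flip_coord x i) - f x)\<^sup>2) / (2 * CARD('d))"
proof -
  obtain c where c: "\<And>x i. 0 \<le> c x i \<and> c x i \<le> 1" and P: "P = glauber_kernel c p"
    using assms by (auto simp: is_glauber_kernel_def)
  define h where "h x i = parallel_sum (pmf p x) (pmf p (flip_coord x i))" for x i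
  have h_flip: "h (flip_coord x i) i = h x i" for x i
    by (simp add: h_def parallel_sum_commute)
  define S where "S i = (\<Sum>x\<in>UNIV. h x i * f x * (f (flip_coord x i) - f x))" for i
  have S: "S i = - (\<Sum>x\<in>UNIV. h x i * (f (flip_coord x i) - f x)\<^sup>2) / 2" for i
  proof -
    \<comment> \<open>Substituting the flip of \<open>x\<close> for \<open>x\<close> keeps the
      weight \<open>h\<close> and exchanges the two values of \<open>f\<close>; adding both forms of
      \<open>S i\<close> gives minus a square.\<close>
    have "S i = (\<Sum>x\<in>UNIV. h x i * f (flip_coord x i) * (f x - f (flip_coord x i)))"
      unfolding S_def
      by (subst sum.reindex_bij_betw[OF bij_flip_coord[of i], symmetric]) (simp add: h_flip)
    then have "2 * S i = (\<Sum>x\<in>UNIV. h x i * f x * (f (flip_coord x i) - f x)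
        + h x i * f (flip_coord x i) * (f x - f (flip_coord x i)))"
      by (simp add: S_def sum.distrib)
    also have "\<dots> = - (\<Sum>x\<in>UNIV. h x i * (f (flip_coord x i) - f x)\<^sup>2)"
      unfolding sum_negf[symmetric]
      by (intro sum.cong refl) (simp add: power2_eq_square algebra_simps)
    finally show ?thesis by simp
  qed
  have "inner_pmf p f (generator P f)
      = (\<Sum>x\<in>UNIV. \<Sum>i\<in>UNIV. (pmf p x * flip_prob c p x i) * f x * (f (flip_coord x i) - f x))
        / CARD('d)"
    by (simp add: inner_pmf_def P generator_glauber_kernel[OF c] sum_distrib_left
        sum_distrib_right sum_divide_distrib mult_ac)
  also have "\<dots> = (\<Sum>i\<in>UNIV. S i) / CARD('d)"
    unfolding S_def h_def pmf_mult_flip_prob by (subst sum.swap) simp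
  finally show ?thesis
    by (simp add: S h_def sum_negf sum_divide_distrib)
qed

theorem proposition7:
  fixes m :: nat
    and w :: "nat \<Rightarrow> real"
    and p :: "('d::finite \<Rightarrow> bool) pmf"
    and pk :: "nat \<Rightarrow> ('d \<Rightarrow> bool) pmf"
    and P :: "('d \<Rightarrow> bool) \<Rightarrow> ('d \<Rightarrow> bool) pmf"
    and Pk :: "nat \<Rightarrow> ('d \<Rightarrow> bool) \<Rightarrow> ('d \<Rightarrow> bool) pmf"
    and f :: "('d \<Rightarrow> bool) \<Rightarrow> real"
  assumes w_pos: "\<And>k. k \<in> {1..m} \<Longrightarrow> w k > 0"
    and w_sum: "(\<Sum>k=1..m. w k) = 1"
    and mixture: "\<And>x. pmf p x = (\<Sum>k=1..m. w k * pmf (pk k) x)"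
    and P: "is_glauber_kernel p P"
    and Pk: "\<And>k. k \<in> {1..m} \<Longrightarrow> is_glauber_kernel (pk k) (Pk k)"
  shows "inner_pmf p f (generator P f)
      \<le> (\<Sum>k=1..m. w k * inner_pmf (pk k) f (generator (Pk k) f))"
proof -
  define h where "h q x i = parallel_sum (pmf q x) (pmf q (flip_coord x i))"
    for q :: "('d \<Rightarrow> bool) pmf" and x i
  define D where "D x i = (f (flip_coord x i) - f x)\<^sup>2" for x i
  \<comment> \<open>The sum over \<open>k\<close> moves innermost, so that superadditivity applies
    to each pair \<open>x\<close>, \<open>i\<close> separately, with the nonnegative factor
    \<open>D x i\<close> unaffected by the mixing.\<close>
  have "(\<Sum>k=1..m. w k * (\<Sum>i\<in>UNIV. \<Sum>x\<in>UNIV. h (pk k) x i * D x i))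
      = (\<Sum>i\<in>UNIV. \<Sum>k=1..m. \<Sum>x\<in>UNIV. w k * h (pk k) x i * D x i)"
    by (subst sum.swap) (simp add: sum_distrib_left mult.assoc)
  also have "\<dots> = (\<Sum>i\<in>UNIV. \<Sum>x\<in>UNIV. (\<Sum>k=1..m. w k * h (pk k) x i) * D x i)"
    by (subst sum.swap[of _ _ "{1..m}"]) (simp add: sum_distrib_right)
  also have "\<dots> \<le> (\<Sum>i\<in>UNIV. \<Sum>x\<in>UNIV. h p x i * D x i)"
    unfolding h_def mixture
    by (intro sum_mono mult_right_mono sum_parallel_sum_le)
       (auto simp: D_def intro!: less_imp_le[OF w_pos])
  finally have le: "(\<Sum>k=1..m. w k * (\<Sum>i\<in>UNIV. \<Sum>x\<in>UNIV. h (pk k) x i * D x i))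
      \<le> (\<Sum>i\<in>UNIV. \<Sum>x\<in>UNIV. h p x i * D x i)" .
  have "inner_pmf p f (generator P f)
      = - (\<Sum>i\<in>UNIV. \<Sum>x\<in>UNIV. h p x i * D x i) / (2 * CARD('d))"
    by (simp only: inner_pmf_generator_glauber[OF P] h_def D_def)
  \<comment> \<open>The minus sign turns the larger edge weights of the mixture into the upper
    bound.\<close>
  also have "\<dots> \<le> - (\<Sum>k=1..m. w k * (\<Sum>i\<in>UNIV. \<Sum>x\<in>UNIV. h (pk k) x i * D x i))
      / (2 * CARD('d))"
    using le by (intro divide_right_mono) simp_all
  also have "\<dots> = (\<Sum>k=1..m. w k * (- (\<Sum>i\<in>UNIV. \<Sum>x\<in>UNIV. h (pk k) x i * D x i)
      / (2 * CARD('d))))"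
    by (simp add: sum_negf flip: sum_divide_distrib)
  also have "\<dots> = (\<Sum>k=1..m. w k * inner_pmf (pk k) f (generator (Pk k) f))"
    by (intro sum.cong refl) (simp only: inner_pmf_generator_glauber[OF Pk] h_def D_def)
  finally show ?thesis .
qed

end
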